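(* For every integer $n \geq 5$, $rsat(n,C_4) = 3\left\lceil \frac{n-1}{2}\right\rceil$.
   Context: All graphs are finite, simple and undirected. An edge-coloring of a graph $G$ is a function $\mathcal{C}:E(G)\to\mathbb{N}$; a (sub)graph is rainbow if all its edges have distinct colors. Given a graph $F$, an edge-colored graph $G$ is $F$-rainbow free if it contains no rainbow copy of $F$, and it is $F$-rainbow saturated if it is $F$-rainbow free but adding any nonedge of $G$ with any color on it creates a rainbow copy of $F$. The rainbow saturation number $rsat(n,F)$ is the minimum number of edges of a graph $G$ on $n$ vertices for which some edge-coloring makes $G$ $F$-rainbow saturated. $C_r$ denotes the cycle on $r$ vertices. *)

theory Defs
  imports Complex_Main "HOL-Library.Ramsey"
begin

datatype 'a graph = Graph (verts: "'a set") (edges: "'a set set")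

definition simple_graph :: "'a graph \<Rightarrow> bool" where
  "simple_graph G \<longleftrightarrow> finite (verts G) \<and> edges G \<subseteq> nsets (verts G) 2"

definition subgraph :: "'a graph \<Rightarrow> 'a graph \<Rightarrow> bool" where
  "subgraph H G \<longleftrightarrow> simple_graph H \<and> verts H \<subseteq> verts G \<and> edges H \<subseteq> edges G"

definition graph_iso :: "'a graph \<Rightarrow> 'b graph \<Rightarrow> bool" where
  "graph_iso G H \<longleftrightarrow>
     (\<exists>f. bij_betw f (verts G) (verts H) \<and> edges H = (\<lambda>e. f ` e) ` edges G)"

definition add_edge :: "'a graph \<Rightarrow> 'a set \<Rightarrow> 'a graph" where
  "add_edge G e = Graph (verts G) (insert e (edges G))"

text \<open>
  The vertices of \<open>cycle_graph r\<close> are the residues modulo \<open>r\<close>; this is the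
  cycle on \<open>r\<close> vertices only when \<open>r \<ge> 3\<close>.
\<close>

definition cycle_graph :: "nat \<Rightarrow> nat graph" where
  "cycle_graph r = Graph {..<r} {{i, (i + 1) mod r} | i. i < r}"

text \<open>
  An edge-coloring of \<open>G\<close> is represented by a total function on vertex sets, of which
  only the values on \<open>edges G\<close> are relevant.
\<close>

type_synonym 'a coloring = "'a set \<Rightarrow> nat"

definition rainbow :: "'a graph \<Rightarrow> 'a coloring \<Rightarrow> bool" where
  "rainbow H c \<longleftrightarrow> inj_on c (edges H)"

definition has_rainbow_copy :: "'b graph \<Rightarrow> 'a graph \<Rightarrow> 'a coloring \<Rightarrow> bool" where
  "has_rainbow_copy F G c \<longleftrightarrow> (\<exists>H. subgraph H G \<and> graph_iso F H \<and> rainbow H c)"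

definition rainbow_free :: "'b graph \<Rightarrow> 'a graph \<Rightarrow> 'a coloring \<Rightarrow> bool" where
  "rainbow_free F G c \<longleftrightarrow> \<not> has_rainbow_copy F G c"

definition rainbow_saturated :: "'b graph \<Rightarrow> 'a graph \<Rightarrow> 'a coloring \<Rightarrow> bool" where
  "rainbow_saturated F G c \<longleftrightarrow>
     rainbow_free F G c \<and>
     (\<forall>e \<in> nsets (verts G) 2 - edges G. \<forall>k :: nat.
        has_rainbow_copy F (add_edge G e) (c(e := k)))"

text \<open>
  Up to isomorphism every finite graph has natural numbers as vertices, so ranging over
  \<open>nat graph\<close> loses no generality.  The minimum exists whenever \<open>F\<close> has at least two
  edges, since a monochromatic complete graph is then (vacuously) rainbow saturated.
\<close>

definition rsat :: "nat \<Rightarrow> 'b graph \<Rightarrow> nat" where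
  "rsat n F = (LEAST m. \<exists>(G :: nat graph) c.
     simple_graph G \<and> card (verts G) = n \<and> rainbow_saturated F G c \<and> card (edges G) = m)"

end

theory Submission
  imports Defs
begin

text \<open>
  Lower bound.  If \<open>uv\<close> is a nonedge of a rainbow \<open>C\<^sub>4\<close>-saturated graph and \<open>f\<close> an edge, then
  colouring \<open>uv\<close> like \<open>f\<close> must create a rainbow \<open>C\<^sub>4\<close>, so some path of length 3 from \<open>u\<close> to \<open>v\<close>
  avoids \<open>f\<close>.  This uncoloured property already forces \<open>3 \<lfloor>n/2\<rfloor>\<close> edges.  It gives minimum degree
  at least 2, and if no vertex has degree 2 the degree sum suffices.  Otherwise let \<open>x\<close> have
  neighbours \<open>y, z\<close>: the paths of length 3 starting at \<open>x\<close> show that every other vertex has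
  neighbours in \<open>N(y) \<union> N(z)\<close>, and a discharging argument yields \<open>3 (n - 1) / 2\<close>.  For even
  \<open>n\<close> only two near-extremal configurations remain, and each contains a nonedge all of whose
  paths of length 3 share an edge.

  Upper bound.  For odd \<open>n\<close> take triangles sharing a vertex, with all edge colours distinct.  For
  even \<open>n\<close> replace one triangle by a \<open>K\<^sub>4\<close> coloured by its three perfect matchings.
\<close>

section \<open>Degree sums in simple graphs\<close>

lemma edge_in_nsets:
  assumes "E \<subseteq> nsets V 2" "{u, v} \<in> E"
  shows "u \<in> V" "v \<in> V" "u \<noteq> v"
proof -
  have "{u, v} \<in> nsets V 2" using assms by blast
  then have "{u, v} \<subseteq> V" "card {u, v} = 2" by (auto simp: nsets_def)
  then show "u \<in> V" "v \<in> V" "u \<noteq> v" by auto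
qed

text \<open>Double counting of incident pairs of a vertex and an edge. Mapping \<open>w\<close> to
  \<open>{v, w}\<close> turns neighbours of \<open>v\<close> into edges at \<open>v\<close>.\<close>

lemma handshake:
  assumes "finite V" "E \<subseteq> nsets V 2"
  shows "(\<Sum>v\<in>V. card {w. {v, w} \<in> E}) = 2 * card E"
proof -
  have fE: "finite E" using assms by (meson finite_imp_finite_nsets finite_subset)
  have c: "card {w. {v, w} \<in> E} = card {e \<in> E. v \<in> e}" for v
  proof (rule bij_betw_same_card)
    show "bij_betw (\<lambda>w. {v, w}) {w. {v, w} \<in> E} {e \<in> E. v \<in> e}"
    proof (rule bij_betw_imageI)
      show "inj_on (\<lambda>w. {v, w}) {w. {v, w} \<in> E}" by (auto simp: inj_on_def doubleton_eq_iff)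
      show "(\<lambda>w. {v, w}) ` {w. {v, w} \<in> E} = {e \<in> E. v \<in> e}"
      proof (intro set_eqI iffI)
        fix e assume e: "e \<in> {e \<in> E. v \<in> e}"
        then have "card e = 2" using assms(2) by (auto simp: nsets_def)
        then obtain a b where "e = {a, b}" by (auto simp: card_2_iff)
        then show "e \<in> (\<lambda>w. {v, w}) ` {w. {v, w} \<in> E}" using e by (auto simp: insert_commute)
      qed auto
    qed
  qed
  have "(\<Sum>v\<in>V. card {e \<in> E. v \<in> e}) = (\<Sum>e\<in>E. 2)"
  proof (rule sum_multicount_gen)
    show "\<forall>e\<in>E. card {v \<in> V. v \<in> e} = 2"
    proof
      fix e assume "e \<in> E"
      then have "e \<subseteq> V" "card e = 2" using assms(2) by (auto simp: nsets_def)
      moreover from this have "{v \<in> V. v \<in> e} = e" by auto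
      ultimately show "card {v \<in> V. v \<in> e} = 2" by simp
    qed
  qed (use assms fE in auto)
  then show ?thesis by (simp add: c)
qed

section \<open>Graphs with paths of length 3 avoiding a prescribed edge\<close>

text \<open>This is what saturation leaves once colours are forgotten. The set \<open>f\<close> is
  arbitrary: an edge is an obstacle to be avoided, and any other choice asks only for some path of
  length 3.\<close>

locale path_robust =
  fixes V :: "'a set" and E :: "'a set set"
  assumes finV: "finite V" and EV: "E \<subseteq> nsets V 2"
    and detour: "\<lbrakk>u \<in> V; v \<in> V; u \<noteq> v; {u, v} \<notin> E\<rbrakk> \<Longrightarrow>
      \<exists>p q. distinct [u, p, q, v] \<and> {u, p} \<in> E \<and> {p, q} \<in> E \<and> {q, v} \<in> E \<and>
        {u, p} \<noteq> f \<and> {p, q} \<noteq> f \<and> {q, v} \<noteq> f"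
begin

definition nb :: "'a \<Rightarrow> 'a set" where "nb v = {w. {v, w} \<in> E}"

lemma nb_sym: "w \<in> nb v \<longleftrightarrow> v \<in> nb w"
  by (simp add: nb_def insert_commute)

lemma nb_V: "w \<in> nb v \<Longrightarrow> v \<in> V \<and> w \<in> V \<and> v \<noteq> w"
  using edge_in_nsets[OF EV] by (auto simp: nb_def)

lemma finite_nb: "finite (nb v)"
  by (rule finite_subset[OF _ finV]) (use nb_V in auto)

lemma sum_deg: "(\<Sum>v\<in>V. card (nb v)) = 2 * card E"
  unfolding nb_def by (rule handshake[OF finV EV])

lemma detour_nb:
  assumes "u \<in> V" "v \<in> V" "u \<noteq> v" "v \<notin> nb u"
  obtains p q where "p \<in> nb u" "q \<in> nb p" "v \<in> nb q" "q \<noteq> u" "p \<noteq> v"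
    "{u, p} \<noteq> f" "{p, q} \<noteq> f" "{q, v} \<noteq> f"
  using detour[of u v f] assms by (auto simp: nb_def)

text \<open>A path of length 3 to a non-neighbour gives one neighbour, and a path avoiding its first
  edge gives another. A vertex with no non-neighbour is adjacent to all the others.\<close>

lemma two_le_deg:
  assumes "3 \<le> card V" "v \<in> V"
  shows "2 \<le> card (nb v)"
proof (cases "\<exists>w\<in>V. w \<noteq> v \<and> w \<notin> nb v")
  case True
  then obtain w where w: "w \<in> V" "w \<noteq> v" "w \<notin> nb v" by auto
  obtain p where p: "p \<in> nb v" using detour_nb[of v w] w assms(2) by metis
  obtain p' where p': "p' \<in> nb v" "{v, p'} \<noteq> {v, p}"
    using detour_nb[of v w "{v, p}"] w assms(2) by metis
  have "p \<noteq> p'" using p'(2) by auto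
  then have "{p, p'} \<subseteq> nb v" "card {p, p'} = 2" using p p' by auto
  then show ?thesis using card_mono[OF finite_nb] by metis
next
  case False
  then have "V - {v} \<subseteq> nb v" by auto
  then have "card (V - {v}) \<le> card (nb v)" by (rule card_mono[OF finite_nb])
  then show ?thesis using assms finV by simp
qed

end

section \<open>Discharging around a vertex of degree 2\<close>

locale path_robust_deg2 = path_robust +
  fixes x y z
  assumes nbx: "nb x = {y, z}" and yz: "y \<noteq> z"
begin

definition "W = V - {x, y, z}"
definition "A = nb y \<inter> W"
definition "B = nb z \<inter> W"
text \<open>Since \<open>y\<close> and \<open>z\<close> are the only neighbours of \<open>x\<close>,
  the vertices at distance 2 from \<open>x\<close> form \<open>U\<close>. Those of \<open>R\<close>
  are at distance 3, because a path of length 3 leads from \<open>x\<close> to each vertex of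
  \<open>W\<close>.\<close>

definition "U = A \<union> B"
definition "R = W - U"
definition "d w = card (nb w \<inter> U)"

text \<open>
  Twice the number of edges charged to \<open>w\<close>: an edge between \<open>R\<close> and \<open>U\<close> goes entirely to its end
  in \<open>R\<close>, an edge inside \<open>U\<close> is split equally, and an edge to \<open>y\<close> or \<open>z\<close> goes to its end in \<open>U\<close>.
\<close>

definition "weight w = (if w \<in> R then 2 * d w
  else 2 * of_bool (w \<in> A) + 2 * of_bool (w \<in> B) + d w)"

lemma xyz: "x \<in> V" "y \<in> V" "z \<in> V" "x \<noteq> y" "x \<noteq> z" "x \<in> nb y" "x \<in> nb z"
  using nb_V[of y x] nb_V[of z x] nbx nb_sym[of x y] nb_sym[of x z] by auto

lemma finW: "finite W" and finU: "finite U" and finR: "finite R"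
  and finA: "finite A" and finB: "finite B"
  using finV by (auto simp: W_def U_def A_def B_def R_def)

lemma W_not_nbx: "w \<in> W \<Longrightarrow> x \<notin> nb w"
  using nb_sym nbx by (auto simp: W_def)

lemma mem_A: "w \<in> A \<longleftrightarrow> w \<in> nb y \<and> w \<noteq> x \<and> w \<noteq> z"
  using nb_V by (auto simp: A_def W_def)

lemma mem_B: "w \<in> B \<longleftrightarrow> w \<in> nb z \<and> w \<noteq> x \<and> w \<noteq> y"
  using nb_V by (auto simp: B_def W_def)

lemma card_W: "card W + 3 = card V"
proof -
  have "card {x, y, z} = 3" using xyz yz by auto
  moreover have "card W = card V - card {x, y, z}"
    unfolding W_def by (rule card_Diff_subset) (use xyz in auto)
  moreover have "card {x, y, z} \<le> card V" by (rule card_mono) (use xyz finV in auto)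
  ultimately show ?thesis by simp
qed

text \<open>The path has the form \<open>x\<close>, \<open>p\<close>, \<open>q\<close>,
  \<open>w\<close>. Its second vertex is \<open>y\<close> or \<open>z\<close>, so its third is in
  \<open>U\<close> or is the other one of \<open>y\<close> and \<open>z\<close>.\<close>

lemma detour_W:
  assumes "w \<in> W"
  obtains p q where "p = y \<or> p = z" "q \<in> nb p" "q \<in> nb w" "q \<noteq> x" "q \<in> U \<or> q = y \<or> q = z"
    "{x, p} \<noteq> f" "{p, q} \<noteq> f" "{q, w} \<noteq> f"
proof -
  have "w \<in> V" "x \<noteq> w" "w \<notin> nb x" using assms nbx by (auto simp: W_def)
  from detour_nb[OF xyz(1) this, of f] obtain p q where
    pq: "p \<in> nb x" "q \<in> nb p" "w \<in> nb q" "q \<noteq> x" "{x, p} \<noteq> f" "{p, q} \<noteq> f" "{q, w} \<noteq> f"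
    by metis
  show thesis
    by (rule that[of p q]) (use pq nbx nb_sym in \<open>auto simp: U_def mem_A mem_B\<close>)
qed

text \<open>Forbidding the edge \<open>{y, z}\<close> leaves only paths from \<open>x\<close> to
  \<open>w\<close> whose third vertex lies in \<open>U\<close>.\<close>

lemma one_le_d:
  assumes "w \<in> W" shows "\<exists>q. q \<in> nb w \<inter> U"
proof -
  obtain p q where "p = y \<or> p = z" "q \<in> nb p" "q \<in> nb w" "q \<noteq> x" "q \<in> U \<or> q = y \<or> q = z"
    "{p, q} \<noteq> {y, z}" by (rule detour_W[OF assms, of "{y, z}"])
  moreover have "p \<noteq> q" using calculation nb_V by blast
  ultimately show ?thesis by (auto simp: insert_commute)
qed

text \<open>Forbidding the edge from \<open>w\<close> to a first neighbour in \<open>U\<close>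
  produces a second one. The path cannot pass through both \<open>y\<close> and \<open>z\<close>:
  either these are not adjacent, or \<open>w\<close> is in \<open>R\<close> and so adjacent to
  neither.\<close>

lemma two_le_d:
  assumes "w \<in> W" "w \<in> R \<or> z \<notin> nb y" shows "2 \<le> d w"
proof -
  obtain q where q: "q \<in> nb w \<inter> U" using one_le_d assms(1) by blast
  obtain p q' where pq: "p = y \<or> p = z" "q' \<in> nb p" "q' \<in> nb w" "q' \<noteq> x" "q' \<in> U \<or> q' = y \<or> q' = z"
    "{q', w} \<noteq> {q, w}" by (rule detour_W[OF assms(1), of "{q, w}"])
  have "q' \<in> U"
    using pq assms nb_V nb_sym[of q' w] nb_sym[of y z]
    by (auto simp: R_def U_def A_def B_def)
  then have "{q, q'} \<subseteq> nb w \<inter> U" "card {q, q'} = 2" using pq q by auto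
  then show ?thesis unfolding d_def using card_mono[of "nb w \<inter> U"] finite_nb by (metis finite_Int)
qed

text \<open>Forbidding \<open>{x, z}\<close> forces the path to leave \<open>x\<close> through
  \<open>y\<close>. Its third vertex is not \<open>z\<close>, as \<open>w\<close> is outside
  \<open>B\<close>, and hence lies in \<open>A\<close>.\<close>

lemma nb_via_y:
  assumes "w \<in> W" "w \<notin> B" shows "\<exists>q. q \<in> nb w \<inter> A"
proof -
  obtain p q where "p = y \<or> p = z" "q \<in> nb p" "q \<in> nb w" "q \<noteq> x" "{x, p} \<noteq> {x, z}"
    by (rule detour_W[OF assms(1), of "{x, z}"])
  then show ?thesis using assms nb_sym[of q w] by (auto simp: mem_A B_def)
qed

lemma nb_via_z:
  assumes "w \<in> W" "w \<notin> A" shows "\<exists>q. q \<in> nb w \<inter> B"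
proof -
  obtain p q where "p = y \<or> p = z" "q \<in> nb p" "q \<in> nb w" "q \<noteq> x" "{x, p} \<noteq> {x, y}"
    by (rule detour_W[OF assms(1), of "{x, y}"])
  then show ?thesis using assms nb_sym[of q w] by (auto simp: mem_B A_def)
qed

lemma deg_W:
  assumes "w \<in> W"
  shows "card (nb w) = of_bool (w \<in> A) + of_bool (w \<in> B) + d w + card (nb w \<inter> R)"
proof -
  define Y where "Y = (if w \<in> A then {y} else {})"
  define Z where "Z = (if w \<in> B then {z} else {})"
  have Y: "card Y = of_bool (w \<in> A)" "finite Y" "Y \<subseteq> {y}" by (auto simp: Y_def)
  have Z: "card Z = of_bool (w \<in> B)" "finite Z" "Z \<subseteq> {z}" by (auto simp: Z_def)
  have split: "nb w = Y \<union> (Z \<union> ((nb w \<inter> U) \<union> (nb w \<inter> R)))"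
    using assms W_not_nbx[OF assms] nb_V[of _ w] nb_sym[of w y] nb_sym[of w z]
    by (auto simp: Y_def Z_def U_def R_def A_def B_def W_def)
  have 1: "card ((nb w \<inter> U) \<union> (nb w \<inter> R)) = d w + card (nb w \<inter> R)"
    unfolding d_def by (rule card_Un_disjoint) (use finite_nb in \<open>auto simp: R_def\<close>)
  have 2: "card (Z \<union> ((nb w \<inter> U) \<union> (nb w \<inter> R))) = card Z + card ((nb w \<inter> U) \<union> (nb w \<inter> R))"
    by (rule card_Un_disjoint)
      (use finite_nb Z in \<open>auto simp: R_def U_def A_def B_def W_def\<close>)
  have "card (nb w) = card Y + card (Z \<union> ((nb w \<inter> U) \<union> (nb w \<inter> R)))"
    by (subst split, rule card_Un_disjoint)
      (use finite_nb Z Y yz in \<open>auto simp: R_def U_def A_def B_def W_def\<close>)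
  then show ?thesis using 1 2 Y Z by simp
qed

lemma deg_y: "card (nb y) = 1 + card A + of_bool (z \<in> nb y)"
proof -
  have eq: "nb y = (if z \<in> nb y then insert x (insert z A) else insert x A)"
    using mem_A xyz by auto
  have x: "x \<notin> A" "z \<notin> A" by (auto simp: A_def W_def)
  have "card (if z \<in> nb y then insert x (insert z A) else insert x A) = 1 + card A + of_bool (z \<in> nb y)"
    using finA xyz x by simp
  then show ?thesis using arg_cong[OF eq, of card] by (rule trans[rotated])
qed

lemma deg_z: "card (nb z) = 1 + card B + of_bool (z \<in> nb y)"
proof -
  have eq: "nb z = (if z \<in> nb y then insert x (insert y B) else insert x B)"
    using mem_B xyz nb_sym[of z y] by auto
  have x: "x \<notin> B" "y \<notin> B" by (auto simp: B_def W_def)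
  have "card (if z \<in> nb y then insert x (insert y B) else insert x B) = 1 + card B + of_bool (z \<in> nb y)"
    using finB xyz x by simp
  then show ?thesis using arg_cong[OF eq, of card] by (rule trans[rotated])
qed

text \<open>The degrees of \<open>x\<close>, \<open>y\<close>, \<open>z\<close> supply the constant
  terms and one copy each of \<open>card A\<close> and \<open>card B\<close>; the ends in
  \<open>W\<close> of the edges to \<open>y\<close> and \<open>z\<close> supply the second copies.
  Moving the \<open>U\<close> end of each edge between \<open>U\<close> and \<open>R\<close> over to
  \<open>R\<close> doubles \<open>d\<close> there. Edges inside \<open>R\<close> carry no weight and
  form the last sum.\<close>

lemma weight_sum:
  "2 * card E = 4 + 2 * of_bool (z \<in> nb y) + (\<Sum>w\<in>W. weight w) + (\<Sum>w\<in>R. card (nb w \<inter> R))"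
proof -
  have WUR: "W = U \<union> R" "U \<inter> R = {}" by (auto simp: R_def U_def A_def B_def)
  have sp: "sum g W = sum g U + sum g R" for g :: "'a \<Rightarrow> nat"
    using WUR sum.union_disjoint[OF finU finR] by metis
  have AB: "A \<subseteq> W" "B \<subseteq> W" by (auto simp: A_def B_def)
  have sA: "(\<Sum>w\<in>W. of_bool (w \<in> A)) = card A"
    using AB finW by (simp add: of_bool_def sum.If_cases Int_absorb1)
  have sB: "(\<Sum>w\<in>W. of_bool (w \<in> B)) = card B"
    using AB finW by (simp add: of_bool_def sum.If_cases Int_absorb1)
  \<comment> \<open>The edges between \<open>U\<close> and \<open>R\<close> are counted from both
    sides.\<close>
  have sw: "(\<Sum>w\<in>U. card (nb w \<inter> R)) = (\<Sum>w\<in>R. d w)"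
  proof -
    have "(\<Sum>w\<in>U. card {v \<in> R. v \<in> nb w}) = (\<Sum>w\<in>R. d w)"
    proof (rule sum_multicount_gen[OF finU finR], rule ballI)
      fix j
      have "{i \<in> U. j \<in> nb i} = nb j \<inter> U" using nb_sym by auto
      then show "card {i \<in> U. j \<in> nb i} = d j" by (simp add: d_def)
    qed
    moreover have "{v \<in> R. v \<in> nb w} = nb w \<inter> R" for w by auto
    ultimately show ?thesis by simp
  qed
  have V3: "V = insert x (insert y (insert z W))" using xyz by (auto simp: W_def)
  have "(\<Sum>v\<in>V. card (nb v)) = card (nb x) + (card (nb y) + (card (nb z) + (\<Sum>v\<in>W. card (nb v))))"
    using finW xyz yz by (subst V3) (auto simp: W_def)
  moreover have "card (nb x) = 2" using nbx yz by simp
  moreover have "(\<Sum>v\<in>W. card (nb v)) = card A + card B + (\<Sum>w\<in>W. d w) + (\<Sum>w\<in>W. card (nb w \<inter> R))"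
    by (simp add: deg_W sum.distrib sA[symmetric] sB[symmetric])
  moreover have "(\<Sum>w\<in>W. weight w) = 2 * card A + 2 * card B + (\<Sum>w\<in>U. d w) + 2 * (\<Sum>w\<in>R. d w)"
  proof -
    have "(\<Sum>w\<in>W. weight w) = (\<Sum>w\<in>W. 2 * of_bool (w \<in> A) + 2 * of_bool (w \<in> B)
        + (if w \<in> R then 2 * d w else d w))"
      by (rule sum.cong) (auto simp: weight_def R_def U_def)
    also have "\<dots> = 2 * card A + 2 * card B + (\<Sum>w\<in>W. if w \<in> R then 2 * d w else d w)"
      by (simp add: sum.distrib sA[symmetric] sB[symmetric] sum_distrib_left)
    also have "(\<Sum>w\<in>W. if w \<in> R then 2 * d w else d w)
      = (\<Sum>w\<in>U. if w \<in> R then 2 * d w else d w) + (\<Sum>w\<in>R. if w \<in> R then 2 * d w else d w)"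
      by (rule sp)
    also have "(\<Sum>w\<in>U. if w \<in> R then 2 * d w else d w) = (\<Sum>w\<in>U. d w)"
      by (rule sum.cong) (use WUR in auto)
    also have "(\<Sum>w\<in>R. if w \<in> R then 2 * d w else d w) = 2 * (\<Sum>w\<in>R. d w)"
      by (simp add: sum_distrib_left)
    finally show ?thesis by simp
  qed
  ultimately show ?thesis using sum_deg deg_y deg_z sp[of d] sp[of "\<lambda>w. card (nb w \<inter> R)"] sw
    by simp
qed

section \<open>Edge bounds in the presence of a vertex of degree 2\<close>

text \<open>Every weight is at least 4, so twice the number of edges is at least
  \<open>4 * card V - 8\<close>. This suffices except for six vertices, where it gives 16 instead of
  18. There a vertex in both \<open>A\<close> and \<open>B\<close> has weight at least 6, and if
  there is none, \<open>A\<close> and \<open>B\<close> do not fit into the three vertices of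
  \<open>W\<close>.\<close>

lemma bound_nonadjacent:
  assumes n: "5 \<le> card V" and nadj: "z \<notin> nb y"
  shows "3 * (card V div 2) \<le> card E"
proof -
  have w4: "4 \<le> weight w" if "w \<in> W" for w
    using two_le_d[OF that] nadj that by (auto simp: weight_def R_def U_def)
  have "(\<Sum>w\<in>W. 4) \<le> (\<Sum>w\<in>W. weight w)" by (rule sum_mono) (use w4 in auto)
  then have e: "4 + 4 * card W \<le> 2 * card E" using weight_sum by simp
  show ?thesis
  proof (cases "card V = 6")
    case False
    then have "card V = 5 \<or> card V = 7 \<or> 8 \<le> card V" using n by linarith
    then show ?thesis using e card_W by auto
  next
    case True
    then have W3: "card W = 3" using card_W by simp
    show ?thesis
    proof (cases "A \<inter> B = {}")
      case False
      then obtain s where s: "s \<in> A" "s \<in> B" by auto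
      then have sW: "s \<in> W" by (simp add: A_def)
      then have "6 \<le> weight s" using s two_le_d[OF sW] nadj by (simp add: weight_def R_def U_def)
      moreover have "(\<Sum>w\<in>W - {s}. 4) \<le> (\<Sum>w\<in>W - {s}. weight w)"
        by (rule sum_mono) (use w4 in auto)
      ultimately have "14 \<le> (\<Sum>w\<in>W. weight w)"
        using sum.remove[OF finW sW, of weight] W3 sW finW by simp
      then show ?thesis using weight_sum True by simp
    next
      case dis: True
      obtain w where w: "w \<in> W" using W3 by (metis card.empty ex_in_conv zero_neq_numeral)
      have two: "2 \<le> card S" if "finite S" "a \<in> S" "b \<in> S" "a \<noteq> b" for S and a b :: 'a
        using card_mono[of S "{a, b}"] that by auto
      \<comment> \<open>Each of \<open>A\<close> and \<open>B\<close> is nonempty by the degrees of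
        \<open>y\<close> and \<open>z\<close>. With \<open>A\<close> and \<open>B\<close> disjoint,
        each of their vertices has a neighbour in its own set, so both sets have at least two
        elements.\<close>
      have "\<exists>a. a \<in> A"
      proof -
        have "2 \<le> card (nb y)" by (rule two_le_deg) (use n xyz in auto)
        then have "0 < card A" using deg_y nadj by simp
        then show ?thesis by (metis card.empty ex_in_conv less_irrefl)
      qed
      then obtain a where a: "a \<in> A" by auto
      then obtain a' where a': "a' \<in> A" "a' \<in> nb a" using nb_via_y[of a] dis by (auto simp: A_def)
      have "\<exists>b. b \<in> B"
      proof -
        have "2 \<le> card (nb z)" by (rule two_le_deg) (use n xyz in auto)
        then have "0 < card B" using deg_z nadj by simp
        then show ?thesis by (metis card.empty ex_in_conv less_irrefl)
      qed
      then obtain b where b: "b \<in> B" by auto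
      then obtain b' where b': "b' \<in> B" "b' \<in> nb b" using nb_via_z[of b] dis by (auto simp: B_def)
      have "2 \<le> card A" using two[OF finA a a'(1)] a' nb_V by blast
      moreover have "2 \<le> card B" using two[OF finB b b'(1)] b' nb_V by blast
      moreover have "card (A \<union> B) \<le> card W" by (rule card_mono[OF finW]) (auto simp: A_def B_def)
      ultimately show ?thesis using card_Un_disjoint[OF finA finB dis] W3 by simp
    qed
  qed
qed

lemma nb_U_single:
  assumes "d w = 1" "u \<in> nb w" "u \<in> U" "v \<in> nb w" "v \<in> U"
  shows "u = v"
proof -
  obtain s where "nb w \<inter> U = {s}" using assms(1) by (auto simp: d_def card_1_singleton_iff)
  then show ?thesis using assms by (metis IntI singletonD)
qed

text \<open>Membership in \<open>A\<close> and \<open>B\<close> contributes 2 or 4, so the only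
  possibility is 2 + 1.\<close>

lemma weight3:
  assumes "w \<in> U" "weight w = 3"
  shows "d w = 1" "w \<in> A \<longleftrightarrow> w \<notin> B"
  using assms one_le_d[of w] by (auto simp: weight_def R_def U_def A_def B_def of_bool_def split: if_splits)

text \<open>First near-extremal configuration: \<open>v\<close> has exactly two neighbours,
  \<open>a\<close> in \<open>A\<close> and \<open>b\<close> in \<open>B\<close>. Let
  \<open>a'\<close> be the neighbour of \<open>a\<close> in \<open>A\<close>. A path of length 3
  from \<open>v\<close> to \<open>a'\<close> avoiding \<open>{v, a}\<close> would run through
  \<open>b\<close> and then \<open>a\<close>, but \<open>a'\<close> is the only neighbour of
  \<open>a\<close> in \<open>U\<close>.\<close>

lemma no_single_R:
  assumes R: "R = {v}" and dv: "d v = 2" and U3: "\<And>w. w \<in> U \<Longrightarrow> weight w = 3"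
  shows False
proof -
  have v: "v \<in> W" "v \<notin> A" "v \<notin> B" using R by (auto simp: R_def U_def)
  obtain a where a: "a \<in> nb v" "a \<in> A" using nb_via_y v by blast
  obtain b where b: "b \<in> nb v" "b \<in> B" using nb_via_z v by blast
  have U: "a \<in> U" "b \<in> U" using a b by (auto simp: U_def)
  have aB: "a \<notin> B" and bA: "b \<notin> A" and da: "d a = 1"
    using weight3[OF U(1) U3[OF U(1)]] weight3[OF U(2) U3[OF U(2)]] a b by auto
  have "a \<noteq> b" using b aB by blast
  then have "{a, b} = nb v \<inter> U"
    by (intro card_subset_eq) (use finite_nb a b U dv in \<open>auto simp: d_def\<close>)
  moreover have "t \<in> U" if t: "t \<in> nb v" for t
  proof (rule ccontr)
    assume "t \<notin> U"
    moreover have "t \<noteq> x" using W_not_nbx[OF v(1)] t by auto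
    moreover have "t \<noteq> y" using t v nb_sym[of v y] by (auto simp: A_def)
    moreover have "t \<noteq> z" using t v nb_sym[of v z] by (auto simp: B_def)
    ultimately have "t \<in> R" using nb_V[OF t] by (simp add: R_def W_def)
    then show False using R nb_V[OF t] by simp
  qed
  ultimately have nv: "nb v \<subseteq> {a, b}" by auto
  obtain a' where a': "a' \<in> nb a" "a' \<in> A" using nb_via_y[of a] a aB by (auto simp: A_def)
  have a'U: "a' \<in> U" using a' by (simp add: U_def)
  have a'B: "a' \<notin> B" and da': "d a' = 1" using weight3[OF a'U U3[OF a'U]] a' by auto
  have a'V: "a' \<in> W" "a' \<noteq> a" using a' nb_V by (auto simp: A_def)
  have "a' \<noteq> v" "a' \<notin> nb v" using a' v nv bA a'V by auto
  then obtain p q where pq: "p \<in> nb v" "q \<in> nb p" "a' \<in> nb q" "q \<noteq> v" "{v, p} \<noteq> {v, a}"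
    using detour_nb[of v a' "{v, a}"] v a'V by (metis W_def DiffD1)
  then have "p = b" using nv by auto
  then have qb: "q \<in> nb b" using pq by simp
  have qa': "q \<in> nb a'" using pq nb_sym by auto
  have "q \<noteq> x" using W_not_nbx a'V qa' by auto
  have "q \<noteq> z" using qa' a'B a'V nb_sym[of z a'] by (auto simp: B_def)
  have "q \<noteq> y" using qb bA b nb_sym[of y b] by (auto simp: A_def B_def)
  have "q \<in> U" using \<open>q \<noteq> x\<close> \<open>q \<noteq> z\<close> \<open>q \<noteq> y\<close> pq R nb_V[of q p] by (auto simp: R_def W_def)
  then have "q = a" using nb_U_single[OF da' qa'] a' nb_sym[of a' a] a by (auto simp: U_def)
  then have "b \<in> nb a" using qb nb_sym by auto
  then have "b = a'" using nb_U_single[OF da] a' b by (auto simp: U_def)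
  then show False using bA a' by simp
qed

text \<open>Second near-extremal configuration: the two neighbours \<open>l\<close> and
  \<open>r\<close> of \<open>t\<close> in \<open>U\<close> turn out to have no neighbours besides
  \<open>y\<close> and \<open>t\<close>. Hence every path of length 3 from \<open>l\<close> to
  \<open>r\<close> uses the edge \<open>{y, t}\<close>.\<close>

lemma no_path_in_A:
  assumes R: "R = {}" and t: "t \<in> A" "d t = 2" and U3: "\<And>w. w \<in> U \<Longrightarrow> w \<noteq> t \<Longrightarrow> weight w = 3"
    and tB: "t \<notin> B"
  shows False
proof -
  obtain l r where lr: "nb t \<inter> U = {l, r}" "l \<noteq> r" using t(2) by (auto simp: d_def card_2_iff)
  have N: "s \<in> A \<and> nb s \<subseteq> {y, t} \<and> s \<in> V" if s: "s \<in> nb t \<inter> U" for s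
  proof -
    have st: "s \<noteq> t" using s nb_V by auto
    have sU: "s \<in> U" using s by simp
    have sd: "d s = 1" and sAB: "s \<in> A \<longleftrightarrow> s \<notin> B" using weight3[OF sU U3[OF sU st]] by auto
    have sW: "s \<in> W" using s by (auto simp: U_def A_def B_def)
    have only: "u = t" if "u \<in> nb s" "u \<in> U" for u
      using nb_U_single[OF sd that, of t] s nb_sym[of s t] t by (auto simp: U_def)
    \<comment> \<open>Outside \<open>A\<close>, \<open>s\<close> would need a neighbour in
      \<open>B\<close>, but its only neighbour in \<open>U\<close> is \<open>t\<close>.\<close>
    have sA: "s \<in> A" using nb_via_z[OF sW] only tB by (auto simp: U_def)
    have "u \<in> {y, t}" if u: "u \<in> nb s" for u
    proof -
      have "u \<noteq> x" using W_not_nbx[OF sW] u by auto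
      moreover have "u \<noteq> z" using u sA sAB sW nb_sym[of z s] by (auto simp: B_def)
      ultimately show ?thesis using only[OF u] u R nb_V[OF u] by (auto simp: R_def W_def)
    qed
    then show ?thesis using sA sW by (auto simp: W_def)
  qed
  have l: "l \<in> A" "nb l \<subseteq> {y, t}" "l \<in> V" and r: "r \<in> A" "nb r \<subseteq> {y, t}" "r \<in> V"
    using N lr by auto
  have "r \<notin> nb l" using l(2) r(1) lr nb_V[of r y] nb_V[of r t] by (auto simp: A_def)
  then obtain p q where pq: "p \<in> nb l" "q \<in> nb p" "r \<in> nb q" "{p, q} \<noteq> {y, t}"
    using detour_nb[of l r "{y, t}"] l r lr by metis
  have "p \<in> {y, t}" "q \<in> {y, t}" "p \<noteq> q" using pq l r nb_sym[of q r] nb_V[of q p] by auto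
  then show False using pq by auto
qed

text \<open>Every weight is at least 3, so twice the number of edges is at least
  \<open>3 * card V - 3\<close>. By parity a counterexample has an even number of vertices and
  exceeds this by exactly 1. One vertex \<open>t\<close> then has weight 4 and all others have
  weight 3, which leaves the two configurations excluded above.\<close>

lemma bound_adjacent:
  assumes n: "5 \<le> card V" and adj: "z \<in> nb y"
  shows "3 * (card V div 2) \<le> card E"
proof (rule ccontr)
  assume less: "\<not> ?thesis"
  have wR: "4 \<le> weight w" "w \<in> W" if "w \<in> R" for w
    using two_le_d[of w] that by (auto simp: weight_def R_def)
  have d1: "1 \<le> d w" if "w \<in> W" for w
    using one_le_d[OF that] finU by (auto simp: d_def Suc_le_eq card_gt_0_iff)
  have w3: "3 \<le> weight w" if "w \<in> W" for w
  proof (cases "w \<in> R")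
    case False
    then show ?thesis using d1[OF that] that by (auto simp: weight_def R_def U_def)
  qed (use wR in fastforce)
  have mono: "3 * card S \<le> sum weight S" if "S \<subseteq> W" for S
    using sum_bounded_below[of S 3 weight] w3 that by (auto simp: mult.commute)
  have total: "2 * card E = 6 + (\<Sum>w\<in>W. weight w) + (\<Sum>w\<in>R. card (nb w \<inter> R))"
    using weight_sum adj by simp
  have "6 + 3 * card W \<le> 2 * card E" using mono[of W] total by simp
  then have tight: "2 * card E = 7 + 3 * card W"
  proof (cases "even (card V)")
    case True
    then obtain k where "card V = 2 * k" by (elim evenE)
    then show ?thesis using less card_W \<open>6 + 3 * card W \<le> 2 * card E\<close> by simp presburger
  next
    case False
    then obtain k where "card V = 2 * k + 1" by (elim oddE)
    then show ?thesis using less card_W \<open>6 + 3 * card W \<le> 2 * card E\<close> by simp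
  qed
  have le: "sum weight W \<le> 3 * card W + 1" using total tight by linarith
  \<comment> \<open>Vertices of \<open>R\<close> weigh at least 4, so if there are any, one of them
    takes the surplus. Otherwise the sum over \<open>R\<close> vanishes and the surplus must occur
    among the weights.\<close>
  obtain t where t: "t \<in> W" "4 \<le> weight t" "R \<noteq> {} \<Longrightarrow> t \<in> R"
  proof (cases "R = {}")
    case True
    have "\<exists>t\<in>W. weight t \<noteq> 3"
    proof (rule ccontr)
      assume "\<not> ?thesis"
      then have "sum weight W = 3 * card W" by simp
      then show False using total tight True by simp
    qed
    then obtain t where "t \<in> W" "weight t \<noteq> 3" by blast
    then show thesis using that[of t] True w3[of t] by auto
  next
    case False
    then show thesis using that wR by blast
  qed
  have t4: "weight t = 4"
    using sum.remove[OF finW t(1), of weight] mono[of "W - {t}"] le t finW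
      card_Suc_Diff1[OF finW t(1)] by auto
  have others: "weight s = 3" if s: "s \<in> W" "s \<noteq> t" for s
  proof -
    have s': "s \<in> W - {t}" "finite (W - {t})" using s finW by auto
    have "sum weight W = weight t + (weight s + sum weight (W - {t} - {s}))"
      using sum.remove[OF finW t(1), of weight] sum.remove[OF s'(2,1), of weight] by simp
    moreover have "3 * card (W - {t} - {s}) \<le> sum weight (W - {t} - {s})" by (rule mono) auto
    moreover have "card W = Suc (Suc (card (W - {t} - {s})))"
      using card_Suc_Diff1[OF finW t(1)] card_Suc_Diff1[OF s'(2,1)] by simp
    ultimately show ?thesis using le t4 w3[OF s(1)] by linarith
  qed
  show False
  proof (cases "R = {}")
    case False
    have "R = {t}"
    proof -
      have "r = t" if "r \<in> R" for r using wR[OF that] others[of r] by fastforce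
      then show ?thesis using False by blast
    qed
    moreover have "d t = 2" using t4 False t(3) by (simp add: weight_def)
    moreover have "weight w = 3" if "w \<in> U" for w
      by (rule others) (use that \<open>R = {t}\<close> in \<open>auto simp: U_def A_def B_def R_def\<close>)
    ultimately show False by (rule no_single_R)
  next
    case True
    have tU: "t \<in> U" using True t(1) by (auto simp: R_def)
    have UW: "U \<subseteq> W" by (auto simp: U_def A_def B_def)
    \<comment> \<open>The weight 4 splits as 2 + 2, since 4 + 0 would contradict \<open>d t\<close>
      being at least 1.\<close>
    have dt: "d t = 2" "t \<in> A \<longleftrightarrow> t \<notin> B"
      using t4 d1[OF t(1)] True tU by (auto simp: weight_def U_def of_bool_def split: if_splits)
    show False
    proof (cases "t \<in> A")
      case tA: True
      show False by (rule no_path_in_A[OF True tA dt(1)]) (use others UW dt tA in auto)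
    next
      case False
      \<comment> \<open>Exchanging \<open>y\<close> and \<open>z\<close> swaps \<open>A\<close> and
        \<open>B\<close> and keeps everything else, which reduces \<open>t\<close> in
        \<open>B\<close> to the case already treated.\<close>
      interpret sw: path_robust_deg2 V E x z y
        by unfold_locales (use nbx yz in auto)
      have W: "sw.W = W" by (auto simp: sw.W_def W_def)
      have AB: "sw.A = B" "sw.B = A" by (simp_all add: sw.A_def sw.B_def A_def B_def W)
      have U: "sw.U = U" by (auto simp: sw.U_def U_def AB)
      have R: "sw.R = R" by (simp add: sw.R_def R_def W U)
      have d: "sw.d = d" by (simp add: sw.d_def d_def U fun_eq_iff)
      have weight: "sw.weight = weight" by (simp add: sw.weight_def weight_def R d AB fun_eq_iff)
      show False
        by (rule sw.no_path_in_A[of t]) (use others UW dt False True in \<open>auto simp: AB U R d weight\<close>)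
    qed
  qed
qed

end

lemma (in path_robust) card_edges_ge:
  assumes "5 \<le> card V"
  shows "3 * (card V div 2) \<le> card E"
proof (cases "\<exists>x\<in>V. card (nb x) = 2")
  case True
  then obtain x y z where "nb x = {y, z}" "y \<noteq> z" by (auto simp: card_2_iff)
  then interpret path_robust_deg2 V E x y z by unfold_locales
  show ?thesis using bound_adjacent bound_nonadjacent assms by blast
next
  case False
  have "3 \<le> card (nb v)" if "v \<in> V" for v
    using two_le_deg[OF _ that] False that assms by fastforce
  then have "card V * 3 \<le> (\<Sum>v\<in>V. card (nb v))"
    using sum_bounded_below[of V 3 "\<lambda>v. card (nb v)"] by simp
  then show ?thesis using sum_deg by linarith
qed

section \<open>Rainbow 4-cycles as quadruples of vertices\<close>

definition rainbow_4cycle :: "'a set set \<Rightarrow> 'a coloring \<Rightarrow> 'a \<Rightarrow> 'a \<Rightarrow> 'a \<Rightarrow> 'a \<Rightarrow> bool" where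
  "rainbow_4cycle E c p q r s \<longleftrightarrow> distinct [p, q, r, s] \<and>
     {p, q} \<in> E \<and> {q, r} \<in> E \<and> {r, s} \<in> E \<and> {s, p} \<in> E \<and>
     distinct [c {p, q}, c {q, r}, c {r, s}, c {s, p}]"

lemma edges_cycle_graph_4: "edges (cycle_graph 4) = {{0, 1}, {1, 2}, {2, 3}, {3, 0}}"
proof -
  have "{{i, (i + 1) mod 4} | i. i < (4::nat)} = (\<lambda>i. {i, (i + 1) mod 4}) ` {..<4}" by auto
  also have "{..<4} = {0, 1, 2, 3::nat}" by auto
  finally show ?thesis by (simp add: cycle_graph_def del: One_nat_def)
qed

text \<open>A copy is read off from the images of 0, 1, 2, 3, and conversely. Four distinct vertices
  give four distinct edges, so injectivity of the colouring on the edge set amounts to distinctness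
  of the list of colours.\<close>

lemma has_rainbow_C4_iff:
  assumes "simple_graph G"
  shows "has_rainbow_copy (cycle_graph 4) G c \<longleftrightarrow> (\<exists>p q r s. rainbow_4cycle (edges G) c p q r s)"
proof
  assume "has_rainbow_copy (cycle_graph 4) G c"
  then obtain H f where H: "subgraph H G" "rainbow H c"
    and f: "bij_betw f {..<4} (verts H)" "edges H = (\<lambda>e. f ` e) ` edges (cycle_graph 4)"
    by (auto simp: has_rainbow_copy_def graph_iso_def cycle_graph_def)
  have inj: "inj_on f {..<4}" using f(1) by (rule bij_betw_imp_inj_on)
  have ne: "f 0 \<noteq> f 1" "f 0 \<noteq> f 2" "f 0 \<noteq> f 3" "f 1 \<noteq> f 2" "f 1 \<noteq> f 3" "f 2 \<noteq> f 3"
    using inj by (auto dest!: inj_onD)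
  have E: "edges H = {{f 0, f 1}, {f 1, f 2}, {f 2, f 3}, {f 3, f 0}}"
    unfolding f(2) edges_cycle_graph_4 by simp
  have "inj_on c (edges H)" using H by (simp add: rainbow_def)
  then have "rainbow_4cycle (edges G) c (f 0) (f 1) (f 2) (f 3)"
    using ne H(1) by (auto simp: rainbow_4cycle_def E subgraph_def inj_on_def doubleton_eq_iff)
  then show "\<exists>p q r s. rainbow_4cycle (edges G) c p q r s" by blast
next
  assume "\<exists>p q r s. rainbow_4cycle (edges G) c p q r s"
  then obtain p q r s where C: "rainbow_4cycle (edges G) c p q r s" by blast
  define H where "H = Graph {p, q, r, s} {{p, q}, {q, r}, {r, s}, {s, p}}"
  define f where "f i = [p, q, r, s] ! i" for i
  have fs: "f 0 = p" "f 1 = q" "f 2 = r" "f 3 = s" by (simp_all add: f_def)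
  have EG: "edges G \<subseteq> nsets (verts G) 2" using assms by (simp add: simple_graph_def)
  have "simple_graph H" using C by (auto simp: simple_graph_def H_def rainbow_4cycle_def nsets_def)
  moreover have "{p, q, r, s} \<subseteq> verts G"
    using C edge_in_nsets[OF EG] by (auto simp: rainbow_4cycle_def)
  ultimately have "subgraph H G" using C by (auto simp: subgraph_def H_def rainbow_4cycle_def)
  moreover have "rainbow H c"
    using C by (auto simp: rainbow_def H_def rainbow_4cycle_def inj_on_def)
  moreover have "graph_iso (cycle_graph 4) H"
    unfolding graph_iso_def
  proof (intro exI conjI)
    have "{..<4} = {0, 1, 2, 3::nat}" by auto
    then have "bij_betw f {..<4} {p, q, r, s}"
      using C by (auto simp: bij_betw_def inj_on_def fs rainbow_4cycle_def simp flip: One_nat_def)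
    then show "bij_betw f (verts (cycle_graph 4)) (verts H)" by (simp add: cycle_graph_def H_def)
    show "edges H = (\<lambda>e. f ` e) ` edges (cycle_graph 4)"
      unfolding edges_cycle_graph_4 by (simp add: H_def fs del: One_nat_def)
  qed
  ultimately show "has_rainbow_copy (cycle_graph 4) G c" by (auto simp: has_rainbow_copy_def)
qed

lemma simple_add_edge:
  assumes "simple_graph G" "e \<in> nsets (verts G) 2"
  shows "simple_graph (add_edge G e)"
  using assms by (simp add: simple_graph_def add_edge_def)

lemma rainbow_4cycle_rotate: "rainbow_4cycle E c p q r s \<Longrightarrow> rainbow_4cycle E c q r s p"
  by (auto simp: rainbow_4cycle_def)

lemma rainbow_4cycle_reverse: "rainbow_4cycle E c p q r s \<Longrightarrow> rainbow_4cycle E c q p s r"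
  by (auto simp: rainbow_4cycle_def insert_commute)

text \<open>Give \<open>{u, v}\<close> the colour of \<open>f\<close>. The rainbow 4-cycle that
  arises must use \<open>{u, v}\<close>, and its other three edges differ in colour from
  \<open>f\<close>, hence differ from \<open>f\<close>.\<close>

lemma saturated_path_robust:
  assumes G: "simple_graph G" and sat: "rainbow_saturated (cycle_graph 4) G c"
  shows "path_robust (verts G) (edges G)"
proof
  show "finite (verts G)" "edges G \<subseteq> nsets (verts G) 2" using G by (auto simp: simple_graph_def)
  fix u v f assume uv: "u \<in> verts G" "v \<in> verts G" "u \<noteq> v" "{u, v} \<notin> edges G"
  define c' where "c' = c({u, v} := c f)"
  have N: "{u, v} \<in> nsets (verts G) 2" using uv by (auto simp: nsets_def)
  then have "has_rainbow_copy (cycle_graph 4) (add_edge G {u, v}) c'"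
    using sat uv by (auto simp: rainbow_saturated_def c'_def)
  then obtain p q r s where C: "rainbow_4cycle (insert {u, v} (edges G)) c' p q r s"
    using has_rainbow_C4_iff[OF simple_add_edge[OF G N]] by (auto simp: add_edge_def)
  have free: "\<not> rainbow_4cycle (edges G) c p q r s" for p q r s
    using sat has_rainbow_C4_iff[OF G] by (auto simp: rainbow_saturated_def rainbow_free_def)
  have "\<exists>p q r s. rainbow_4cycle (insert {u, v} (edges G)) c' p q r s \<and> {p, q} = {u, v}"
  proof (rule ccontr)
    assume no: "\<not> ?thesis"
    have "{p, q} \<noteq> {u, v}" "{q, r} \<noteq> {u, v}" "{r, s} \<noteq> {u, v}" "{s, p} \<noteq> {u, v}"
      using no C rainbow_4cycle_rotate by metis+
    then have "rainbow_4cycle (edges G) c p q r s"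
      using C by (simp add: rainbow_4cycle_def c'_def)
    then show False using free by blast
  qed
  \<comment> \<open>Reversing the cycle if necessary, it traverses the new edge from
    \<open>v\<close> to \<open>u\<close>; the rest is the path \<open>u\<close>, \<open>p\<close>,
    \<open>q\<close>, \<open>v\<close>.\<close>
  then obtain p q where "rainbow_4cycle (insert {u, v} (edges G)) c' v u p q"
    using rainbow_4cycle_reverse by (metis doubleton_eq_iff)
  then show "\<exists>p q. distinct [u, p, q, v] \<and> {u, p} \<in> edges G \<and> {p, q} \<in> edges G \<and> {q, v} \<in> edges G \<and>
      {u, p} \<noteq> f \<and> {p, q} \<noteq> f \<and> {q, v} \<noteq> f"
    by (intro exI[of _ p] exI[of _ q])
      (auto simp: rainbow_4cycle_def c'_def insert_commute doubleton_eq_iff split: if_splits)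
qed

section \<open>The windmill and its colouring\<close>

text \<open>
  The hub is 0.  For even \<open>n\<close> the vertices 1, 2, 3 form one blade, which makes a \<open>K\<^sub>4\<close> with the hub;
  all other blades are pairs.
\<close>

definition blade :: "nat \<Rightarrow> nat \<Rightarrow> nat" where
  "blade n x = (if odd n then (x + 1) div 2 else max 1 (x div 2))"

definition joined :: "nat \<Rightarrow> nat \<Rightarrow> nat \<Rightarrow> bool" where
  "joined n x y \<longleftrightarrow> x < n \<and> y < n \<and> x \<noteq> y \<and> (x = 0 \<or> y = 0 \<or> blade n x = blade n y)"

definition windmill :: "nat \<Rightarrow> nat graph" where
  "windmill n = Graph {..<n} {{x, y} | x y. joined n x y}"

text \<open>
  In the \<open>K\<^sub>4\<close> on 0, 1, 2, 3 the colour \<open>6 - (i + j)\<close> of \<open>{i, j}\<close> is the third element \<open>k\<close> of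
  \<open>{1, 2, 3}\<close>, which is also the colour of the opposite edge \<open>{0, k}\<close>.  The condition \<open>\<Sum>e \<le> 5\<close>
  singles out the edges inside the blade 1, 2, 3.
\<close>

definition windmill_color :: "nat \<Rightarrow> nat coloring" where
  "windmill_color n e =
     (if 0 \<in> e then \<Sum>e else if even n \<and> \<Sum>e \<le> 5 then 6 - \<Sum>e else n + \<Sum>e)"

lemma joined_sym: "joined n x y \<Longrightarrow> joined n y x"
  by (auto simp: joined_def)

lemma verts_windmill: "verts (windmill n) = {..<n}"
  by (simp add: windmill_def)

lemma windmill_edge: "{x, y} \<in> edges (windmill n) \<longleftrightarrow> joined n x y"
  using joined_sym by (auto simp: windmill_def doubleton_eq_iff)

lemma simple_windmill: "simple_graph (windmill n)"
  by (auto simp: simple_graph_def windmill_def nsets_def joined_def)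

lemma blade_odd: "odd n \<Longrightarrow> x \<noteq> 0 \<Longrightarrow> x + 1 = 2 * blade n x \<or> x = 2 * blade n x"
  unfolding blade_def by simp presburger

lemma blade_even:
  assumes "even n" "x \<noteq> 0"
  shows "blade n x = 1 \<and> x \<in> {1, 2, 3} \<or> 2 \<le> blade n x \<and> (x = 2 * blade n x \<or> x = 2 * blade n x + 1)"
proof (cases "x < 4")
  case True
  then have "x = 1 \<or> x = 2 \<or> x = 3" using assms by auto
  then show ?thesis using assms by (auto simp: blade_def)
next
  case False
  then have "blade n x = x div 2" "2 \<le> x div 2" using assms by (auto simp: blade_def)
  moreover have "x = 2 * (x div 2) \<or> x = 2 * (x div 2) + 1" by presburger
  ultimately show ?thesis by simp
qed

text \<open>All blades are pairs, except the one formed by 1, 2, 3 for even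
  \<open>n\<close>.\<close>

lemma blade_triple:
  assumes "distinct [x, y, z]" "x \<noteq> 0" "y \<noteq> 0" "z \<noteq> 0" "blade n x = blade n y" "blade n y = blade n z"
  shows "even n" "{x, y, z} \<subseteq> {1, 2, 3}"
proof -
  show "even n" using assms blade_odd[of n x] blade_odd[of n y] blade_odd[of n z] by force
  then show "{x, y, z} \<subseteq> {1, 2, 3}"
    using assms blade_even[of n x] blade_even[of n y] blade_even[of n z] by auto
qed

lemma windmill_color_hub: "x \<noteq> 0 \<Longrightarrow> windmill_color n {0, x} = x" "x \<noteq> 0 \<Longrightarrow> windmill_color n {x, 0} = x"
  by (simp_all add: windmill_color_def)

lemma windmill_color_rim:
  assumes "x \<noteq> y" "x \<noteq> 0" "y \<noteq> 0"
  shows "windmill_color n {x, y} = (if even n \<and> x + y \<le> 5 then 6 - (x + y) else n + (x + y))"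
  using assms by (simp add: windmill_color_def)

section \<open>Saturation of the windmill\<close>

text \<open>The other three vertices share a blade and so are 1, 2, 3; then the opposite edges
  \<open>{0, q}\<close> and \<open>{r, s}\<close> have equal colours.\<close>

lemma windmill_C4_not_rainbow_hub:
  "\<not> rainbow_4cycle (edges (windmill n)) (windmill_color n) 0 q r s"
proof
  assume C: "rainbow_4cycle (edges (windmill n)) (windmill_color n) 0 q r s"
  then have *: "distinct [q, r, s]" "q \<noteq> 0" "r \<noteq> 0" "s \<noteq> 0" "blade n q = blade n r" "blade n r = blade n s"
    by (auto simp: rainbow_4cycle_def windmill_edge joined_def)
  have "windmill_color n {r, s} = q"
    using blade_triple[OF *] * by (auto simp: windmill_color_rim)
  moreover have "windmill_color n {0, q} = q" using * by (simp add: windmill_color_hub)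
  ultimately show False using C by (simp add: rainbow_4cycle_def)
qed

text \<open>Up to rotation the hub case is settled. A 4-cycle avoiding the hub would put four
  vertices into one blade.\<close>

lemma windmill_rainbow_free: "rainbow_free (cycle_graph 4) (windmill n) (windmill_color n)"
  unfolding rainbow_free_def has_rainbow_C4_iff[OF simple_windmill]
proof (intro notI, elim exE)
  fix p q r s assume C: "rainbow_4cycle (edges (windmill n)) (windmill_color n) p q r s"
  have nz: "p \<noteq> 0" "q \<noteq> 0" "r \<noteq> 0" "s \<noteq> 0"
    using C windmill_C4_not_rainbow_hub rainbow_4cycle_rotate by metis+
  have j: "joined n p q" "joined n q r" "joined n r s" and "distinct [p, q, r, s]"
    using C by (simp_all add: rainbow_4cycle_def windmill_edge)
  then have b: "blade n p = blade n q" "blade n q = blade n r" "blade n r = blade n s" "distinct [p, q, r, s]"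
    using nz unfolding joined_def by blast+
  have "{p, q, r} \<subseteq> {1, 2, 3}" "{q, r, s} \<subseteq> {1, 2, 3}"
    by (rule blade_triple(2)[of _ _ _ n]; use nz b in simp)+
  then show False using b(4) by auto
qed

lemma mate:
  assumes "4 \<le> n" "x < n" "x \<noteq> 0"
  obtains x' where "x' < n" "x' \<noteq> 0" "x' \<noteq> x" "blade n x' = blade n x"
proof (cases "even n \<and> x \<le> 3")
  case True
  then have "x = 1 \<or> x = 2 \<or> x = 3" using assms by auto
  then show thesis using that[of "if x = 1 then 2 else 1"] True assms by (auto simp: blade_def)
next
  case False
  \<comment> \<open>In a pair, the smaller element is the one with the parity of \<open>n\<close>.
    Parity also excludes \<open>x + 1 = n\<close>.\<close>
  show thesis
  proof (cases "even n = even x")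
    case True
    then have "x + 1 < n" using assms by (metis Suc_eq_plus1 Suc_lessI even_Suc)
    then show thesis using that[of "x + 1"] True False assms by (auto simp: blade_def)
  next
    case ne: False
    then have "x - 1 \<noteq> 0" "x - 1 < n" using False assms by (auto elim: oddE)
    moreover have "blade n (x - 1) = blade n x"
      using ne False assms by (cases "odd n") (auto simp: blade_def elim!: oddE evenE)
    ultimately show thesis using that[of "x - 1"] assms by auto
  qed
qed

text \<open>The colour of an edge inside a blade determines the blade. In a pair it is at least
  \<open>n\<close>, hence no hub colour, and the two elements of blade \<open>b\<close> add up to
  \<open>4 * b - 1\<close> or \<open>4 * b + 1\<close> according to the parity of \<open>n\<close>.
  In the triple it is the remaining vertex. The \<open>of_bool\<close> terms avoid
  subtraction.\<close>

lemma mate_color: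
  assumes "x < n" "x' < n" "x \<noteq> 0" "x' \<noteq> 0" "x' \<noteq> x" "blade n x' = blade n x"
  defines "m \<equiv> windmill_color n {x, x'}"
  shows "m \<noteq> x" "m \<noteq> x'"
    "n \<le> m \<and> m + of_bool (odd n) = n + 4 * blade n x + of_bool (even n) \<or> m < n \<and> blade n m = blade n x"
proof -
  have "(m \<noteq> x \<and> m \<noteq> x') \<and>
    (n \<le> m \<and> m + of_bool (odd n) = n + 4 * blade n x + of_bool (even n) \<or> m < n \<and> blade n m = blade n x)"
  proof (cases "even n")
    case True
    note bx = blade_even[OF True assms(3)] and bx' = blade_even[OF True assms(4), unfolded assms(6)]
    show ?thesis
    proof (cases "blade n x = 1")
      case b1: True
      have x: "x = 1 \<or> x = 2 \<or> x = 3" using bx b1 by simp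
      have x': "x' = 1 \<or> x' = 2 \<or> x' = 3" using bx' b1 by simp
      have "2 < n" using assms(1,2,5) x x' by linarith
      moreover have "n \<noteq> 3" using True by auto
      ultimately have n: "3 < n" by linarith
      have "x + x' \<le> 5" using x x' assms(5) by linarith
      then have m: "m = 6 - (x + x')" using True assms by (simp add: windmill_color_rim)
      have "m \<noteq> x \<and> m \<noteq> x' \<and> (m = 1 \<or> m = 2 \<or> m = 3)" unfolding m using x x' assms(5) by auto
      moreover from this have "blade n m = 1" using True by (auto simp: blade_def)
      ultimately show ?thesis using n b1 by auto
    next
      case False
      then have "x + x' = 4 * blade n x + 1" "2 \<le> blade n x" using bx bx' assms(5) by linarith+
      moreover from this have "m = n + (x + x')" using assms by (simp add: windmill_color_rim)
      ultimately show ?thesis using True assms(1,2) by simp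
    qed
  next
    case False
    have "x + x' + 1 = 4 * blade n x"
      using blade_odd[OF False assms(3)] blade_odd[OF False assms(4), unfolded assms(6)] assms(5)
      by linarith
    moreover have "m = n + (x + x')" using False assms by (simp add: windmill_color_rim)
    ultimately show ?thesis using False assms(1,2) by simp
  qed
  then show "m \<noteq> x" "m \<noteq> x'"
    "n \<le> m \<and> m + of_bool (odd n) = n + 4 * blade n x + of_bool (even n) \<or> m < n \<and> blade n m = blade n x"
    by blast+
qed

text \<open>With mates \<open>x'\<close> and \<open>y'\<close>, the nonedge closes the 4-cycles
  \<open>x\<close>, \<open>y\<close>, 0, \<open>x'\<close> and \<open>y\<close>, \<open>x\<close>,
  0, \<open>y'\<close>. Their old edges use two disjoint sets of three colours, so any colour
  \<open>k\<close> is missing from one of them.\<close>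

lemma windmill_saturated:
  assumes n: "4 \<le> n"
  shows "rainbow_saturated (cycle_graph 4) (windmill n) (windmill_color n)"
  unfolding rainbow_saturated_def
proof (intro conjI ballI allI windmill_rainbow_free)
  fix e k assume e: "e \<in> nsets (verts (windmill n)) 2 - edges (windmill n)"
  then obtain x y where xy: "e = {x, y}" "x \<noteq> y" by (auto simp: nsets_def card_2_iff)
  have lt: "x < n" "y < n" using e xy by (auto simp: nsets_def verts_windmill)
  have nj: "x \<noteq> 0" "y \<noteq> 0" "blade n x \<noteq> blade n y"
    using e xy lt by (auto simp: windmill_edge joined_def)
  obtain x' where x': "x' < n" "x' \<noteq> 0" "x' \<noteq> x" "blade n x' = blade n x" using mate[OF n lt(1) nj(1)] .
  obtain y' where y': "y' < n" "y' \<noteq> 0" "y' \<noteq> y" "blade n y' = blade n y" using mate[OF n lt(2) nj(2)] .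
  define m where "m = windmill_color n {x, x'}"
  define m' where "m' = windmill_color n {y, y'}"
  note mx = mate_color[OF lt(1) x'(1) nj(1) x'(2-4), folded m_def]
  note my = mate_color[OF lt(2) y'(1) nj(2) y'(2-4), folded m'_def]
  have colors: "distinct [y, x', m]" "distinct [x, y', m']" "{y, x', m} \<inter> {x, y', m'} = {}"
  proof -
    have "x' \<noteq> y" "x \<noteq> y'" "x' \<noteq> y'" using x' y' nj(3) by metis+
    \<comment> \<open>The colour \<open>m\<close> is at least \<open>n\<close> or is a vertex in the
      blade of \<open>x\<close>, and symmetrically for \<open>m'\<close>.\<close>
    moreover have "m \<noteq> y" "m \<noteq> y'" "m' \<noteq> x" "m' \<noteq> x'"
      using mx(3) my(3) lt x'(1,4) y'(1,4) nj(3) by (metis leD)+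
    moreover have "m \<noteq> m'"
    proof
      assume "m = m'"
      then have "blade n x = blade n y" using mx(3) my(3) by (cases "m < n") simp_all
      then show False using nj(3) by contradiction
    qed
    ultimately show "distinct [y, x', m]" "distinct [x, y', m']" "{y, x', m} \<inter> {x, y', m'} = {}"
      using mx(1,2) my(1,2) xy(2) x'(3) y'(3) by auto
  qed
  have cyc: "rainbow_4cycle (insert {u, v} (edges (windmill n))) ((windmill_color n)({u, v} := k)) u v 0 u'"
    if "u \<noteq> 0" "v \<noteq> 0" "u' \<noteq> 0" "u < n" "v < n" "u' < n" "u \<noteq> v" "u' \<noteq> u" "u' \<noteq> v" "blade n u' = blade n u"
      "distinct [k, v, u', windmill_color n {u, u'}]" for u v u'
    using that by (auto simp: rainbow_4cycle_def windmill_edge joined_def windmill_color_hub doubleton_eq_iff insert_commute)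
  have "\<exists>p q r s. rainbow_4cycle (insert e (edges (windmill n))) ((windmill_color n)(e := k)) p q r s"
  proof (cases "k \<in> {y, x', m}")
    case False
    then have "rainbow_4cycle (insert {x, y} (edges (windmill n))) ((windmill_color n)({x, y} := k)) x y 0 x'"
      by (intro cyc) (use colors nj x' lt xy in \<open>auto simp: m_def\<close>)
    then show ?thesis using xy by blast
  next
    case True
    then have "k \<notin> {x, y', m'}" using colors by blast
    then have "rainbow_4cycle (insert {y, x} (edges (windmill n))) ((windmill_color n)({y, x} := k)) y x 0 y'"
      by (intro cyc) (use colors nj y' lt xy in \<open>auto simp: m'_def\<close>)
    then show ?thesis using xy by (metis insert_commute)
  qed
  moreover have "simple_graph (add_edge (windmill n) e)"
    using simple_add_edge[OF simple_windmill] e by blast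
  ultimately show "has_rainbow_copy (cycle_graph 4) (add_edge (windmill n) e) ((windmill_color n)(e := k))"
    by (simp add: has_rainbow_C4_iff add_edge_def)
qed

section \<open>Edge count of the windmill and the saturation number\<close>

text \<open>Covering the edges by images of intervals is enough, since the lower bound for saturated
  graphs supplies the other inequality.\<close>

lemma card_windmill_edges:
  assumes "4 \<le> n"
  shows "card (edges (windmill n)) \<le> 3 * (n div 2)"
proof -
  define S where "S = (\<lambda>i. {0, i}) ` {1..<n}"
  have S: "finite S" "card S \<le> n - 1" using card_image_le[of "{1..<n}" "\<lambda>i. {0, i}"] by (auto simp: S_def)
  have hub: "{x, y} \<in> S" if "joined n x y" "x = 0 \<or> y = 0" for x y
    using that by (auto simp: S_def joined_def insert_commute)
  show ?thesis
  proof (cases "odd n")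
    case True
    define P where "P = (\<lambda>i. {2 * i - 1, 2 * i}) ` {1..n div 2}"
    have P: "finite P" "card P \<le> n div 2"
      using card_image_le[of "{1..n div 2}" "\<lambda>i. {2 * i - 1, 2 * i}"] by (auto simp: P_def)
    have "edges (windmill n) \<subseteq> S \<union> P"
    proof
      fix e assume "e \<in> edges (windmill n)"
      then obtain x y where xy: "e = {x, y}" "joined n x y" by (auto simp: windmill_def)
      show "e \<in> S \<union> P"
      proof (cases "x = 0 \<or> y = 0")
        case False
        define b where "b = blade n x"
        have "x + 1 = 2 * b \<and> y = 2 * b \<or> x = 2 * b \<and> y + 1 = 2 * b"
          using blade_odd[OF True, of x] blade_odd[OF True, of y] xy False by (auto simp: joined_def b_def)
        then have "e = {2 * b - 1, 2 * b}" "1 \<le> b" "2 * b < n" using xy by (auto simp: joined_def)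
        then show ?thesis by (auto simp: P_def)
      qed (use hub xy in auto)
    qed
    then have "card (edges (windmill n)) \<le> card (S \<union> P)" by (rule card_mono[rotated]) (use S P in auto)
    also have "\<dots> \<le> n - 1 + n div 2" using card_Un_le[of S P] S P by linarith
    also have "\<dots> = 3 * (n div 2)" using True by (auto elim!: oddE)
    finally show ?thesis .
  next
    case False
    then have ev: "even n" by simp
    \<comment> \<open>The index starts at 2 because blade 1 is the triangle
      \<open>T\<close>.\<close>
    define P where "P = (\<lambda>i. {2 * i, 2 * i + 1}) ` {2..<n div 2}"
    define T where "T = {{1, 2}, {1, 3}, {2, 3::nat}}"
    have P: "finite P" "card P \<le> n div 2 - 2"
      using card_image_le[of "{2..<n div 2}" "\<lambda>i. {2 * i, 2 * i + 1}"] by (auto simp: P_def)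
    have T: "finite T" "card T \<le> 3" by (auto simp: T_def card_insert_if)
    have "edges (windmill n) \<subseteq> S \<union> (P \<union> T)"
    proof
      fix e assume "e \<in> edges (windmill n)"
      then obtain x y where xy: "e = {x, y}" "joined n x y" by (auto simp: windmill_def)
      show "e \<in> S \<union> (P \<union> T)"
      proof (cases "x = 0 \<or> y = 0")
        case nz: False
        define b where "b = blade n x"
        have b: "blade n y = b" "x \<noteq> y" "x < n" "y < n" using xy nz by (auto simp: joined_def b_def)
        note be = blade_even[OF ev, of x] blade_even[OF ev, of y]
        show ?thesis
        proof (cases "b = 1")
          case True
          then have "x \<in> {1, 2, 3}" "y \<in> {1, 2, 3}" using be b nz by (auto simp: b_def)
          then have "e \<in> T" using xy(1) b(2) by (auto simp: T_def insert_commute)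
          then show ?thesis by simp
        next
          case False
          then have "2 \<le> b" "e = {2 * b, 2 * b + 1}" "2 * b + 1 < n"
            using be b nz xy(1) by (auto simp: b_def)
          then show ?thesis by (auto simp: P_def)
        qed
      qed (use hub xy in auto)
    qed
    then have "card (edges (windmill n)) \<le> card (S \<union> (P \<union> T))" by (rule card_mono[rotated]) (use S P T in auto)
    also have "\<dots> \<le> (n - 1) + (n div 2 - 2 + 3)"
      using card_Un_le[of S "P \<union> T"] card_Un_le[of P T] S P T by linarith
    also have "\<dots> = 3 * (n div 2)" using ev assms by (auto elim!: evenE)
    finally show ?thesis .
  qed
qed

lemma rsat_C4:
  assumes "5 \<le> n"
  shows "rsat n (cycle_graph 4) = 3 * (n div 2)"
  unfolding rsat_def
proof (rule Least_equality)
  have ge: "3 * (n div 2) \<le> card (edges G)"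
    if "simple_graph G" "card (verts G) = n" "rainbow_saturated (cycle_graph 4) G c" for G :: "nat graph" and c
    using path_robust.card_edges_ge[OF saturated_path_robust[OF that(1,3)]] that(2) assms by simp
  have sat: "rainbow_saturated (cycle_graph 4) (windmill n) (windmill_color n)"
    using assms by (intro windmill_saturated) simp
  have "card (verts (windmill n)) = n" by (simp add: verts_windmill)
  moreover have "card (edges (windmill n)) = 3 * (n div 2)"
    using card_windmill_edges[of n] ge[OF simple_windmill _ sat] assms by (simp add: verts_windmill)
  ultimately show "\<exists>(G :: nat graph) c. simple_graph G \<and> card (verts G) = n \<and>
      rainbow_saturated (cycle_graph 4) G c \<and> card (edges G) = 3 * (n div 2)"
    using simple_windmill sat by blast
  show "3 * (n div 2) \<le> m" if "\<exists>(G :: nat graph) c. simple_graph G \<and> card (verts G) = n \<and>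
      rainbow_saturated (cycle_graph 4) G c \<and> card (edges G) = m" for m
    using that ge by blast
qed

theorem theorem1p1:
  fixes n :: nat
  assumes "n \<ge> 5"
  shows "int (rsat n (cycle_graph 4)) = 3 * \<lceil>(real n - 1) / 2\<rceil>"
proof -
  have "\<lceil>(real n - 1) / 2\<rceil> = int (n div 2)"
  proof (rule ceiling_unique)
    have "n < 2 * (n div 2) + 2" "2 * (n div 2) \<le> n" by auto
    then have "real n \<le> 2 * real (n div 2) + 1" "2 * real (n div 2) \<le> real n" by linarith+
    then show "real_of_int (int (n div 2)) - 1 < (real n - 1) / 2"
      "(real n - 1) / 2 \<le> real_of_int (int (n div 2))" by auto
  qed
  then show ?thesis using rsat_C4[OF assms] by simp
qed

end
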